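(* Let $f:\mathbb{R}^d\to\mathbb{R}$, let ${\bm{x}}^\star$ be a local minimizer of $f$ with $f$ twice differentiable in a neighborhood of ${\bm{x}}^\star$, and let ${\bm{H}}:=\nabla^2 f({\bm{x}}^\star)$ satisfy ${\bm{H}}\succeq 0$, ${\bm{H}}\neq {\bm{0}}$, with eigenvalues $\lambda_1\ge\cdots\ge\lambda_d\ge 0$, $\lambda_{\max}({\bm{H}}):=\lambda_1$. Consider ZO-GD with step size $\eta>0$ and smoothing parameter $\mu>0$ applied to the quadratic model $f_{\mathrm{quad}}({\bm{x}})=f({\bm{x}}^\star)+\tfrac12({\bm{x}}-{\bm{x}}^\star)^\top{\bm{H}}({\bm{x}}-{\bm{x}}^\star)$, i.e. \[ {\bm{x}}_{t+1}={\bm{x}}_t-\eta\,\frac{f_{\mathrm{quad}}({\bm{x}}_t+\mu{\bm{u}}_t)-f_{\mathrm{quad}}({\bm{x}}_t-\mu{\bm{u}}_t)}{2\mu}\,{\bm{u}}_t,\qquad {\bm{u}}_t\overset{\mathrm{i.i.d.}}{\sim}\mathcal N({\bm{0}},{\bm{I}}_d). \] Then the critical step size in the mean is $\eta^\star_{\mathrm{mean}}=2/\lambda_{\max}({\bm{H}})$, and the mean-square critical step size $\eta^\star_{\mathrm{ms}}$ is the unique $\eta>0$ satisfying \[ \eta\lambda_{\max}({\bm{H}})<1\quad\text{and}\quad \sum_{i=1}^d\frac{\eta\lambda_i}{2(1-\eta\lambda_i)}=1, \] and it satisfies \[ \frac{2}{\Tr({\bm{H}})+2\lambda_{\max}({\bm{H}})}\le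 \eta^\star_{\mathrm{ms}}\le\frac{2}{\Tr({\bm{H}})}. \]
   Context: For an optimizer with step size $\eta$ applied to $f_{\mathrm{quad}}$ producing iterates $\{{\bm{x}}_t\}_{t\ge0}$, the critical step size in the mean is $\eta^\star_{\mathrm{mean}}:=\sup\{\eta>0:\ \forall {\bm{x}}_0\in\mathbb{R}^d,\ \sup_{t\ge0}\|\mathbb{E}[{\bm{x}}_t-{\bm{x}}^\star]\|<\infty\}$ and the mean-square critical step size is $\eta^\star_{\mathrm{ms}}:=\sup\{\eta>0:\ \forall {\bm{x}}_0\in\mathbb{R}^d,\ \sup_{t\ge0}\mathbb{E}\|{\bm{x}}_t-{\bm{x}}^\star\|^2<\infty\}$. *)

theory Defs
  imports "HOL-Analysis.Analysis" "HOL-Probability.Probability"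
begin

definition local_minimizer :: "('a::metric_space \<Rightarrow> real) \<Rightarrow> 'a \<Rightarrow> bool" where
  "local_minimizer f x \<longleftrightarrow> (\<exists>e>0. \<forall>y. dist y x < e \<longrightarrow> f x \<le> f y)"

definition twice_diff_near_with_hessian ::
  "(real^'n \<Rightarrow> real) \<Rightarrow> real^'n \<Rightarrow> real^'n^'n \<Rightarrow> bool" where
  "twice_diff_near_with_hessian f x H \<longleftrightarrow>
     (\<exists>S g. open S \<and> x \<in> S \<and>
        (\<forall>y\<in>S. (f has_derivative (\<lambda>h. g y \<bullet> h)) (at y) \<and> g differentiable (at y)) \<and>
        (g has_derivative (\<lambda>h. H *v h)) (at x))"

definition psd :: "real^'n^'n \<Rightarrow> bool" where
  "psd H \<longleftrightarrow> transpose H = H \<and> (\<forall>v. v \<bullet> (H *v v) \<ge> 0)"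

definition eigenvalues_with_mult :: "real^'n^'n \<Rightarrow> ('n \<Rightarrow> real) \<Rightarrow> bool" where
  "eigenvalues_with_mult H lam \<longleftrightarrow> (\<forall>x. det (mat x - H) = (\<Prod>i\<in>UNIV. x - lam i))"

definition fquad :: "real \<Rightarrow> real^'n^'n \<Rightarrow> real^'n \<Rightarrow> real^'n \<Rightarrow> real" where
  "fquad c H xs x = c + 1/2 * ((x - xs) \<bullet> (H *v (x - xs)))"

definition zo_step :: "(real^'n \<Rightarrow> real) \<Rightarrow> real \<Rightarrow> real \<Rightarrow> real^'n \<Rightarrow> real^'n \<Rightarrow> real^'n" where
  "zo_step F \<eta> \<mu> x u = x - (\<eta> * ((F (x + \<mu> *\<^sub>R u) - F (x - \<mu> *\<^sub>R u)) / (2 * \<mu>))) *\<^sub>R u"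

primrec zo_iter :: "(real^'n \<Rightarrow> real) \<Rightarrow> real \<Rightarrow> real \<Rightarrow> real^'n \<Rightarrow> (nat \<Rightarrow> real^'n) \<Rightarrow> nat \<Rightarrow> real^'n" where
  "zo_iter F \<eta> \<mu> x0 \<omega> 0 = x0"
| "zo_iter F \<eta> \<mu> x0 \<omega> (Suc t) = zo_step F \<eta> \<mu> (zo_iter F \<eta> \<mu> x0 \<omega> t) (\<omega> t)"

definition std_gauss :: "(real^'n) measure" where
  "std_gauss = distr (PiM UNIV (\<lambda>_::'n. std_normal_distribution)) borel (\<lambda>v. vec_lambda v)"

definition gauss_noise :: "(nat \<Rightarrow> real^'n) measure" where
  "gauss_noise = PiM UNIV (\<lambda>_::nat. std_gauss)"

definition crit_step_mean :: "(real^'n \<Rightarrow> real) \<Rightarrow> real \<Rightarrow> real^'n \<Rightarrow> real" where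
  "crit_step_mean F \<mu> xs = Sup {\<eta>. \<eta> > 0 \<and>
     (\<forall>x0. bdd_above (range (\<lambda>t. norm (\<integral>\<omega>. (zo_iter F \<eta> \<mu> x0 \<omega> t - xs) \<partial>gauss_noise))))}"

definition crit_step_ms :: "(real^'n \<Rightarrow> real) \<Rightarrow> real \<Rightarrow> real^'n \<Rightarrow> real" where
  "crit_step_ms F \<mu> xs = Sup {\<eta>. \<eta> > 0 \<and>
     (\<forall>x0. (SUP t. \<integral>\<^sup>+\<omega>. ennreal ((norm (zo_iter F \<eta> \<mu> x0 \<omega> t - xs))\<^sup>2) \<partial>gauss_noise) < \<infinity>)}"

end

theory Submission
  imports Defs "HOL-Combinatorics.Permutations" "HOL-Computational_Algebra.Polynomial"
begin

text \<open>On the quadratic model the error \<open>e = x - xs\<close> evolves by \<open>e \<mapsto> e - \<eta> (u \<bullet> H e) u\<close>. Averaging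
  over \<open>u\<close> multiplies the mean of the \<open>i\<close>-th coordinate in an orthonormal eigenbasis of \<open>H\<close> by
  \<open>1 - \<eta> \<lambda>\<^sub>i\<close>, and Isserlis' formula gives a closed linear recursion for the coordinate second
  moments \<open>m\<^sub>i\<close>, namely
  \<open>m\<^sub>i \<mapsto> (1 - 2 \<eta> \<lambda>\<^sub>i + 2 \<eta>\<^sup>2 \<lambda>\<^sub>i\<^sup>2) m\<^sub>i + \<eta>\<^sup>2 (\<Sum>j. \<lambda>\<^sub>j\<^sup>2 m\<^sub>j)\<close>.
  With the weights \<open>w\<^sub>i = \<eta> \<lambda>\<^sub>i / (2 (1 - \<eta> \<lambda>\<^sub>i))\<close> and \<open>W = \<Sum>i. w\<^sub>i\<close>, the potential \<open>\<Sum>i. w\<^sub>i m\<^sub>i\<close>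
  changes in one step by exactly \<open>(W - 1) \<eta>\<^sup>2 (\<Sum>j. \<lambda>\<^sub>j\<^sup>2 m\<^sub>j)\<close>. For \<open>W < 1\<close> this makes the forcing
  term summable, so all moments stay bounded; for \<open>W > 1\<close> the potential grows geometrically; and for
  \<open>\<eta> \<lambda>\<^sub>m\<^sub>a\<^sub>x \<ge> 1\<close> the top coordinate alone at least doubles.\<close>

section \<open>Orthonormal eigenbases of symmetric matrices\<close>

lemma symmetric_matrix_inner:
  fixes H :: "real^'n^'n"
  assumes "transpose H = H"
  shows "x \<bullet> (H *v y) = (H *v x) \<bullet> y"
  using assms by (metis dot_lmul_matrix transpose_matrix_vector)

text \<open>Variational argument: the quadratic form attains its maximum \<open>c\<close> over the
  compact unit sphere of \<open>S\<close> at some \<open>v\<close>. The residual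
  \<open>w = H v - c v\<close> is orthogonal to \<open>v\<close> and lies in \<open>S\<close>, and
  moving \<open>v\<close> along \<open>w\<close> would beat the maximum to first order unless
  \<open>w = 0\<close>.\<close>

lemma symmetric_matrix_eigenvector_in_subspace:
  fixes H :: "real^'n^'n"
  assumes sym: "transpose H = H" and S: "subspace S" "S \<noteq> {0}"
    and inv: "\<And>x. x \<in> S \<Longrightarrow> H *v x \<in> S"
  obtains v c where "v \<in> S" "norm v = 1" "H *v v = c *\<^sub>R v"
proof -
  let ?K = "S \<inter> sphere 0 1"
  have cS: "compact ?K"
    using closed_subspace[OF S(1)] by (intro closed_Int_compact) auto
  obtain s where s: "s \<in> S" "s \<noteq> 0"
    using S subspace_0[OF S(1)] by blast
  have "(1 / norm s) *\<^sub>R s \<in> ?K"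
    using s S(1) by (auto intro: subspace_scale)
  then have ne: "?K \<noteq> {}" by blast
  have "continuous_on ?K (\<lambda>x. x \<bullet> (H *v x))"
    by (intro continuous_intros linear_continuous_on matrix_vector_mul_bounded_linear)
  then obtain v where v: "v \<in> ?K" and vmax: "\<And>x. x \<in> ?K \<Longrightarrow> x \<bullet> (H *v x) \<le> v \<bullet> (H *v v)"
    using continuous_attains_sup[OF cS ne] by blast
  define c where "c = v \<bullet> (H *v v)"
  have vv: "v \<bullet> v = 1" using v by (simp add: norm_eq_1)
  have ray: "x \<bullet> (H *v x) \<le> c * (x \<bullet> x)" if "x \<in> S" for x
  proof (cases "x = 0")
    case False
    let ?y = "(1 / norm x) *\<^sub>R x"
    have "?y \<in> ?K" using that False S(1) by (auto intro: subspace_scale)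
    from vmax[OF this] have "(x \<bullet> (H *v x)) / (norm x)\<^sup>2 \<le> c"
      by (simp add: c_def matrix_vector_mult_scaleR power2_eq_square)
    then show ?thesis using False by (simp add: field_simps dot_square_norm)
  qed simp
  define w where "w = H *v v - c *\<^sub>R v"
  have wS: "w \<in> S" using v inv S(1) by (auto simp: w_def intro: subspace_diff subspace_scale)
  have wv: "v \<bullet> w = 0" by (simp add: w_def inner_diff_right c_def[symmetric] vv)
  have wHv: "w \<bullet> (H *v v) = w \<bullet> w"
    using wv by (simp add: w_def inner_diff_right inner_diff_left inner_commute)
  \<comment> \<open>This is the bound \<open>ray\<close> at \<open>v + t w\<close>: the constant
    terms cancel, leaving a term linear in \<open>t\<close> against a quadratic one.\<close>
  have main: "2 * t * (w \<bullet> w) \<le> t\<^sup>2 * (c * (w \<bullet> w) - w \<bullet> (H *v w))" for t :: real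
  proof -
    have "v + t *\<^sub>R w \<in> S" using v wS S(1) by (auto intro: subspace_add subspace_scale)
    from ray[OF this] show ?thesis
      using symmetric_matrix_inner[OF sym, of v w] wv wHv
      by (simp add: matrix_vector_right_distrib matrix_vector_mult_scaleR inner_add_left
          inner_add_right c_def[symmetric] vv inner_commute algebra_simps power2_eq_square)
  qed
  have "w \<bullet> w = 0"
  proof (rule ccontr)
    assume "w \<bullet> w \<noteq> 0"
    then have p: "w \<bullet> w > 0" by (simp add: inner_gt_zero_iff)
    define D where "D = c * (w \<bullet> w) - w \<bullet> (H *v w)"
    \<comment> \<open>Small enough that the quadratic side, divided by \<open>t\<close>, is at most
      \<open>w \<bullet> w\<close>; adding 1 covers \<open>D = 0\<close>.\<close>
    define t where "t = (w \<bullet> w) / (\<bar>D\<bar> + 1)"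
    have t: "t > 0" using p by (simp add: t_def)
    have "t * (2 * (w \<bullet> w)) \<le> t * (t * D)"
      using main[of t] by (simp add: D_def[symmetric] power2_eq_square mult_ac)
    then have "2 * (w \<bullet> w) \<le> t * D" using t by simp
    also have "\<dots> \<le> t * (\<bar>D\<bar> + 1)" using t by (intro mult_left_mono) auto
    also have "\<dots> = w \<bullet> w" by (simp add: t_def)
    finally show False using p by simp
  qed
  then have "H *v v = c *\<^sub>R v" by (simp add: w_def)
  then show thesis using v that by auto
qed

text \<open>Spectral theorem by induction on dimension. It is stated for invariant subspaces
  because, by symmetry, the orthogonal complement of an eigenvector inside \<open>S\<close> is again
  invariant and has dimension one less.\<close>

lemma symmetric_matrix_orthonormal_eigenvectors:
  fixes H :: "real^'n^'n"
  assumes sym: "transpose H = H" and "subspace S" and "\<And>x. x \<in> S \<Longrightarrow> H *v x \<in> S"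
  shows "\<exists>B. B \<subseteq> S \<and> finite B \<and> card B = dim S \<and> pairwise orthogonal B \<and>
    (\<forall>b\<in>B. norm b = 1 \<and> (\<exists>c. H *v b = c *\<^sub>R b))"
  using assms(2,3)
proof (induction "dim S" arbitrary: S)
  case 0
  then show ?case by (intro exI[of _ "{}"]) auto
next
  case (Suc k)
  have "S \<noteq> {0}" using Suc.hyps(2) by auto
  with symmetric_matrix_eigenvector_in_subspace[OF sym Suc.prems(1) _ Suc.prems(2)]
  obtain v c where v: "v \<in> S" "norm v = 1" "H *v v = c *\<^sub>R v" by blast
  define T where "T = {x \<in> S. orthogonal v x}"
  have T: "subspace T"
    using Suc.prems(1) subspace_orthogonal_to_vector[of v]
    unfolding T_def by (metis (full_types) Collect_conj_eq Collect_mem_eq subspace_inter)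
  have inv: "H *v x \<in> T" if "x \<in> T" for x
    using that Suc.prems(2) v(3) symmetric_matrix_inner[OF sym, of v x]
    by (auto simp: T_def orthogonal_def)
  have "dim T + dim (span {v}) = dim S"
  proof -
    have "T = {y \<in> S. \<forall>x\<in>span {v}. orthogonal x y}"
      by (auto simp: T_def orthogonal_def span_singleton)
    then show ?thesis
      using dim_subspace_orthogonal_to_vectors[of "span {v}" S] v(1) Suc.prems(1)
      by (simp add: span_minimal)
  qed
  moreover have "dim (span {v}) = 1" using v(2) by (auto simp: dim_singleton)
  ultimately have "k = dim T" using Suc.hyps(2) by simp
  from Suc.hyps(1)[OF this T inv] obtain B where B: "B \<subseteq> T" "finite B" "card B = dim T"
    "pairwise orthogonal B" "\<forall>b\<in>B. norm b = 1 \<and> (\<exists>c. H *v b = c *\<^sub>R b)" by blast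
  have "v \<notin> B" using B(1) v(2) by (auto simp: T_def orthogonal_def)
  then show ?case using B v \<open>k = dim T\<close> Suc.hyps(2)
    by (intro exI[of _ "insert v B"])
      (auto simp: T_def pairwise_insert orthogonal_commute)
qed

text \<open>The family \<open>lam\<close> is known only through the characteristic polynomial. Any
  orthonormal eigenbasis has eigenvalues \<open>d\<close> with the same characteristic polynomial,
  so \<open>lam\<close> is a rearrangement of \<open>d\<close>, and relabelling the basis by that
  permutation aligns the two.\<close>

lemma eigenvalues_with_mult_orthonormal_basis:
  fixes H :: "real^'n^'n"
  assumes sym: "transpose H = H" and ev: "eigenvalues_with_mult H lam"
  obtains v :: "'n \<Rightarrow> real^'n" where "\<And>i j. v i \<bullet> v j = (if i = j then 1 else 0)"
    "\<And>i. H *v v i = lam i *\<^sub>R v i"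
proof -
  from symmetric_matrix_orthonormal_eigenvectors[OF sym subspace_UNIV]
  obtain B where B: "finite B" "card B = CARD('n)" "pairwise orthogonal B"
    and Bn: "\<And>b. b \<in> B \<Longrightarrow> norm b = 1" and Be: "\<And>b. b \<in> B \<Longrightarrow> \<exists>c. H *v b = c *\<^sub>R b"
    by auto
  obtain w :: "'n \<Rightarrow> real^'n" where w: "bij_betw w UNIV B"
    using finite_same_card_bij[of "UNIV :: 'n set" B] B by auto
  then have wB: "w i \<in> B" for i by (auto simp: bij_betw_def)
  have orth: "w i \<bullet> w j = (if i = j then 1 else 0)" for i j
  proof (cases "i = j")
    case False
    then have "w i \<noteq> w j" using w by (auto simp: bij_betw_def inj_def)
    then show ?thesis using False wB[of i] wB[of j] B(3) by (auto simp: pairwise_def orthogonal_def)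
  qed (use Bn[OF wB[of i]] in \<open>simp add: norm_eq_1\<close>)
  obtain d where d: "\<And>i. H *v w i = d i *\<^sub>R w i" using Be[OF wB] by metis
  define P :: "real^'n^'n" where "P = (\<chi> i j. w j $ i)"
  define D :: "real \<Rightarrow> real^'n^'n" where "D = (\<lambda>x. \<chi> i j. if i = j then x - d i else 0)"
  have col: "column i P = w i" for i by (simp add: P_def column_def vec_eq_iff)
  have oP: "orthogonal_matrix P"
    unfolding orthogonal_matrix_orthonormal_columns
    using orth by (auto simp: col norm_eq_1 orthogonal_def)
  \<comment> \<open>Diagonalization is written without an inverse; the determinants are then
    compared by cancelling \<open>det P\<close>.\<close>
  have "(mat x - H) ** P = P ** D x" for x
  proof -
    have "((mat x - H) ** P) $ i $ j = (P ** D x) $ i $ j" for i j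
    proof -
      have "((mat x - H) ** P) $ i $ j = ((mat x - H) *v w j) $ i"
        by (simp add: matrix_matrix_mult_def matrix_vector_mult_def P_def)
      also have "(mat x - H) *v w j = (x - d j) *\<^sub>R w j"
        using d[of j] 
        by (simp add: matrix_vector_mult_diff_rdistrib scaleR_left_diff_distrib)
          (simp add: vec_eq_iff matrix_vector_mult_def mat_def if_distrib if_distribR cong: if_cong)
      also have "\<dots> $ i = (P ** D x) $ i $ j"
        by (simp add: matrix_matrix_mult_def P_def D_def if_distrib cong: if_cong)
      finally show ?thesis .
    qed
    then show ?thesis by (simp add: vec_eq_iff)
  qed
  then have "det (mat x - H) * det P = det P * det (D x)" for x
    by (metis det_mul)
  moreover have "det P \<noteq> 0" using det_orthogonal_matrix[OF oP] by auto
  ultimately have "det (mat x - H) = det (D x)" for x by (metis mult.commute mult_right_cancel)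
  moreover have "det (D x) = (\<Prod>i\<in>UNIV. x - d i)" for x
    by (subst det_diagonal) (auto simp: D_def)
  ultimately have eq: "(\<Prod>i\<in>UNIV. x - d i) = (\<Prod>i\<in>UNIV. x - lam i)" for x
    using ev by (simp add: eigenvalues_with_mult_def)
  \<comment> \<open>Agreement at every real point lifts to equality of polynomials, whose root
    multisets then coincide.\<close>
  have "(\<Prod>i\<in>UNIV. [:- d i, 1:]) = (\<Prod>i\<in>UNIV. [:- lam i, 1:])"
    by (rule poly_eq_poly_eq_iff[THEN iffD1]) (auto simp: poly_prod eq)
  then have "proots (\<Prod>i\<in>UNIV. [:- d i, 1:]) = proots (\<Prod>i\<in>UNIV. [:- lam i, 1:])" by simp
  then have "(\<Sum>i\<in>UNIV. {#d i#}) = (\<Sum>i\<in>UNIV. {#lam i#})"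
    by (subst (asm) (1 2) proots_prod) auto
  then have "image_mset lam (mset_set UNIV) = image_mset d (mset_set UNIV)"
    by (simp add: sum_unfold_sum_mset )
  then obtain p where "p permutes UNIV" and p: "\<forall>i\<in>UNIV. lam i = d (p i)"
    using image_mset_eq_implies_permutes[of "UNIV :: 'n set" lam d] by auto
  then have inj: "p i = p j \<longleftrightarrow> i = j" for i j by (metis permutes_def)
  show thesis
    by (rule that[of "w \<circ> p"]) (use d p inj in \<open>auto simp: orth\<close>)
qed

section \<open>The second-moment recursion\<close>

definition ms_map :: "real \<Rightarrow> ('n::finite \<Rightarrow> real) \<Rightarrow> ('n \<Rightarrow> real) \<Rightarrow> 'n \<Rightarrow> real" where
  "ms_map \<eta> l z = (\<lambda>i. (1 - 2 * (\<eta> * l i) + 2 * (\<eta> * l i)\<^sup>2) * z i + \<eta>\<^sup>2 * (\<Sum>j\<in>UNIV. (l j)\<^sup>2 * z j))"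

text \<open>The left-hand side of the equation that determines the mean-square threshold. Total
  division makes a summand 0 at its pole \<open>\<eta> * l i = 1\<close>, so arguments about its
  value assume that every \<open>\<eta> * l i\<close> is below 1.\<close>

definition ms_sum :: "('n::finite \<Rightarrow> real) \<Rightarrow> real \<Rightarrow> real" where
  "ms_sum l \<eta> = (\<Sum>i\<in>UNIV. \<eta> * l i / (2 * (1 - \<eta> * l i)))"

lemma ms_coeff_pos: "(1::real) - 2 * a + 2 * a\<^sup>2 > 0"
proof -
  have "(1::real) - 2 * a + 2 * a\<^sup>2 = (1 - a)\<^sup>2 + a\<^sup>2" by (simp add: power2_eq_square algebra_simps)
  moreover have "\<dots> > 0" by (cases "a = 0") (auto intro: add_nonneg_pos)
  ultimately show ?thesis by simp
qed

lemma ms_map_nonneg: "(\<And>i. z i \<ge> 0) \<Longrightarrow> ms_map \<eta> l z i \<ge> 0"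
  unfolding ms_map_def
  by (intro add_nonneg_nonneg[of "_ * _"] mult_nonneg_nonneg sum_nonneg less_imp_le[OF ms_coeff_pos])
    auto

lemma ms_map_funpow_nonneg: "(\<And>i. z i \<ge> 0) \<Longrightarrow> (ms_map \<eta> l ^^ t) z i \<ge> 0"
  by (induction t arbitrary: i) (auto intro: ms_map_nonneg)

text \<open>The weights are chosen so that \<open>w i\<close> times the diagonal loss
  \<open>2 * (\<eta> * l i) - 2 * (\<eta> * l i)\<^sup>2\<close> equals
  \<open>(\<eta> * l i)\<^sup>2\<close>. The diagonal losses therefore add up to exactly one forcing
  term, while the coupling returns \<open>ms_sum l \<eta>\<close> times that term.\<close>

lemma ms_map_potential:
  fixes l :: "'n::finite \<Rightarrow> real"
  assumes "\<And>i. \<eta> * l i < 1" and w_def: "w = (\<lambda>i. \<eta> * l i / (2 * (1 - \<eta> * l i)))"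
  shows "(\<Sum>i\<in>UNIV. w i * ms_map \<eta> l z i) =
    (\<Sum>i\<in>UNIV. w i * z i) + (ms_sum l \<eta> - 1) * (\<eta>\<^sup>2 * (\<Sum>j\<in>UNIV. (l j)\<^sup>2 * z j))"
proof -
  let ?Q = "\<eta>\<^sup>2 * (\<Sum>j\<in>UNIV. (l j)\<^sup>2 * z j)"
  have "w i * ms_map \<eta> l z i = w i * z i - \<eta>\<^sup>2 * ((l i)\<^sup>2 * z i) + w i * ?Q" for i
  proof -
    have "1 - \<eta> * l i \<noteq> 0" using assms(1)[of i] by simp
    then have "w i * (1 - 2 * (\<eta> * l i) + 2 * (\<eta> * l i)\<^sup>2) = w i - (\<eta> * l i)\<^sup>2"
      by (simp add: w_def divide_simps) (simp add: power2_eq_square algebra_simps)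
    then have "w i * (1 - 2 * (\<eta> * l i) + 2 * (\<eta> * l i)\<^sup>2) * z i = (w i - (\<eta> * l i)\<^sup>2) * z i"
      by simp
    then show ?thesis
      unfolding ms_map_def distrib_left mult.assoc[symmetric]
      by (simp add: left_diff_distrib power_mult_distrib)
  qed
  then have "(\<Sum>i\<in>UNIV. w i * ms_map \<eta> l z i) =
     (\<Sum>i\<in>UNIV. w i * z i) - ?Q + (\<Sum>i\<in>UNIV. w i) * ?Q"
    by (simp add: sum.distrib sum_subtractf flip: sum_distrib_left sum_distrib_right)
  moreover have "(\<Sum>i\<in>UNIV. w i) = ms_sum l \<eta>" by (simp add: w_def ms_sum_def)
  ultimately show ?thesis by (simp add: algebra_simps)
qed

text \<open>The potential ignores coordinates with \<open>l i = 0\<close>, whose weight vanishes. It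
  is therefore used only to bound the accumulated forcing; each coordinate is then controlled
  directly, since it can grow only through the forcing.\<close>

lemma ms_map_bounded:
  fixes l :: "'n::finite \<Rightarrow> real"
  assumes "\<eta> > 0" and l: "\<And>i. l i \<ge> 0" and less: "\<And>i. \<eta> * l i < 1" and W: "ms_sum l \<eta> < 1"
    and z: "\<And>i. z i \<ge> 0"
  shows "\<exists>C. \<forall>t. (\<Sum>i\<in>UNIV. (ms_map \<eta> l ^^ t) z i) \<le> C"
proof -
  define w where "w = (\<lambda>i. \<eta> * l i / (2 * (1 - \<eta> * l i)))"
  define y where "y = (\<lambda>t. (ms_map \<eta> l ^^ t) z)"
  define Q where "Q = (\<lambda>t. \<eta>\<^sup>2 * (\<Sum>j\<in>UNIV. (l j)\<^sup>2 * y t j))"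
  have y0: "y t i \<ge> 0" for t i unfolding y_def by (rule ms_map_funpow_nonneg[OF z])
  have yS: "y (Suc t) = ms_map \<eta> l (y t)" for t by (simp add: y_def)
  have w0: "w i \<ge> 0" for i
    unfolding w_def using assms(1) l[of i] less[of i] by (intro divide_nonneg_pos) auto
  \<comment> \<open>Telescoped potential identity: what the potential loses is the accumulated
    forcing times \<open>1 - ms_sum l \<eta>\<close>.\<close>
  have V: "(\<Sum>i\<in>UNIV. w i * y t i) + (1 - ms_sum l \<eta>) * (\<Sum>s<t. Q s) = (\<Sum>i\<in>UNIV. w i * z i)" for t
  proof (induction t)
    case (Suc t)
    then show ?case
      using ms_map_potential[OF less w_def, of "y t"]
      unfolding yS sum.lessThan_Suc fun_cong[OF Q_def, of t, symmetric] by (simp add: algebra_simps)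
  qed (simp add: y_def)
  define C where "C = (\<Sum>i\<in>UNIV. w i * z i) / (1 - ms_sum l \<eta>)"
  have Qb: "(\<Sum>s<t. Q s) \<le> C" for t
  proof -
    have "(\<Sum>i\<in>UNIV. w i * y t i) \<ge> 0" by (intro sum_nonneg mult_nonneg_nonneg w0 y0)
    with V[of t] have "(1 - ms_sum l \<eta>) * (\<Sum>s<t. Q s) \<le> (\<Sum>i\<in>UNIV. w i * z i)" by simp
    then show ?thesis using W by (simp add: C_def pos_le_divide_eq mult.commute)
  qed
  have yb: "y t i \<le> z i + (\<Sum>s<t. Q s)" for t i
  proof (induction t)
    case (Suc t)
    have "2 * (\<eta> * l i)\<^sup>2 \<le> 2 * (\<eta> * l i)"
      using less[of i] l[of i] assms(1) by (simp add: power2_eq_square mult_left_le_one_le)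
    then have "(1 - 2 * (\<eta> * l i) + 2 * (\<eta> * l i)\<^sup>2) * y t i \<le> y t i"
      using y0[of t i] ms_coeff_pos[of "\<eta> * l i"]
      by (intro mult_left_le_one_le) auto
    then show ?case using Suc by (simp add: yS ms_map_def Q_def)
  qed (simp add: y_def)
  have "(\<Sum>i\<in>UNIV. y t i) \<le> (\<Sum>i\<in>UNIV. z i + C)" for t
    by (intro sum_mono order.trans[OF yb]) (simp add: Qb)
  then show ?thesis unfolding y_def by blast
qed

lemma geometric_growth:
  fixes V :: "nat \<Rightarrow> real"
  assumes "r > 1" "V 0 > 0" "\<And>t. V (Suc t) \<ge> r * V t"
  shows "\<exists>t. V t > C"
proof -
  have V: "V t \<ge> r ^ t * V 0" for t
  proof (induction t)
    case (Suc t)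
    then have "r * (r ^ t * V 0) \<le> r * V t" using assms(1) by (intro mult_left_mono) auto
    then show ?case using assms(3)[of t] by simp
  qed simp
  obtain t where "C / V 0 < r ^ t" using real_arch_pow[OF assms(1)] by blast
  then show ?thesis using V[of t] assms(2) by (intro exI[of _ t]) (simp add: field_simps)
qed

lemma ms_map_unbounded:
  fixes l :: "'n::finite \<Rightarrow> real"
  assumes "\<eta> > 0" and l: "\<And>i. l i \<ge> 0" and k: "l k > 0"
    and W: "\<eta> * l k \<ge> 1 \<or> ((\<forall>i. \<eta> * l i < 1) \<and> ms_sum l \<eta> > 1)"
    and z: "\<And>i. z i \<ge> 0" "z k > 0"
  shows "\<exists>t. (\<Sum>i\<in>UNIV. (ms_map \<eta> l ^^ t) z i) > C"
proof -
  define y where "y = (\<lambda>t. (ms_map \<eta> l ^^ t) z)"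
  have y0: "y t i \<ge> 0" for t i unfolding y_def by (rule ms_map_funpow_nonneg[OF z(1)])
  have yS: "y (Suc t) = ms_map \<eta> l (y t)" for t by (simp add: y_def)
  from W have "\<exists>t. (\<Sum>i\<in>UNIV. y t i) > C"
  proof (elim disjE conjE)
    assume a: "\<eta> * l k \<ge> 1"
    have "y (Suc t) k \<ge> 2 * y t k" for t
    proof -
      have "(l k)\<^sup>2 * y t k \<le> (\<Sum>j\<in>UNIV. (l j)\<^sup>2 * y t j)"
        by (rule member_le_sum) (auto simp: y0)
      then have "\<eta>\<^sup>2 * ((l k)\<^sup>2 * y t k) \<le> \<eta>\<^sup>2 * (\<Sum>j\<in>UNIV. (l j)\<^sup>2 * y t j)"
        by (intro mult_left_mono) auto
      then have "(1 - 2 * (\<eta> * l k) + 3 * (\<eta> * l k)\<^sup>2) * y t k \<le> y (Suc t) k"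
        by (simp add: yS ms_map_def algebra_simps power_mult_distrib)
      \<comment> \<open>The coefficient 3 combines the diagonal factor 2 with the share of
        coordinate \<open>k\<close> in its own forcing.\<close>
      moreover have "2 \<le> 1 - 2 * (\<eta> * l k) + 3 * (\<eta> * l k)\<^sup>2"
      proof -
        have "0 \<le> (\<eta> * l k - 1) * (3 * (\<eta> * l k) + 1)" using a by (intro mult_nonneg_nonneg) auto
        then show ?thesis by (simp add: power2_eq_square algebra_simps)
      qed
      then have "2 * y t k \<le> (1 - 2 * (\<eta> * l k) + 3 * (\<eta> * l k)\<^sup>2) * y t k"
        using y0 by (intro mult_right_mono) auto
      ultimately show ?thesis by linarith
    qed
    then obtain t where t: "y t k > C"
      using geometric_growth[of 2 "\<lambda>t. y t k" C] z(2) by (auto simp: y_def)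
    have "y t k \<le> (\<Sum>i\<in>UNIV. y t i)" by (rule member_le_sum) (auto simp: y0)
    with t show ?thesis by (intro exI[of _ t]) simp
  next
    assume "\<forall>i. \<eta> * l i < 1" and W: "ms_sum l \<eta> > 1"
    then have less: "\<eta> * l i < 1" for i by blast
    define w where "w = (\<lambda>i. \<eta> * l i / (2 * (1 - \<eta> * l i)))"
    have w0: "w i \<ge> 0" for i
      unfolding w_def using assms(1) l[of i] less[of i] by (intro divide_nonneg_pos) auto
    have wk: "w k > 0" unfolding w_def using assms(1) k less[of k] by (intro divide_pos_pos) auto
    \<comment> \<open>A uniform constant by which the forcing dominates \<open>c\<close> times the
      potential, giving the growth factor \<open>1 + (ms_sum l \<eta> - 1) * c\<close>. The value 1
      is a placeholder for indices with \<open>l i = 0\<close>, where both sides of the comparison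
      vanish.\<close>
    define c where "c = Min (range (\<lambda>i. if l i = 0 then 1 else (\<eta> * l i)\<^sup>2 / w i))"
    have "c \<in> range (\<lambda>i. if l i = 0 then 1 else (\<eta> * l i)\<^sup>2 / w i)"
      unfolding c_def by (rule Min_in) auto
    then obtain i where i: "c = (if l i = 0 then 1 else (\<eta> * l i)\<^sup>2 / w i)" by blast
    have c: "c > 0"
    proof (cases "l i = 0")
      case False
      then have "w i > 0" unfolding w_def using assms(1) l[of i] less[of i]
        by (intro divide_pos_pos) auto
      then show ?thesis using i False assms(1) by simp
    qed (simp add: i)
    have cw: "c * w i \<le> (\<eta> * l i)\<^sup>2" for i
    proof (cases "l i = 0")
      case False
      then have "w i > 0" unfolding w_def using assms(1) l[of i] less[of i]
        by (intro divide_pos_pos) auto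
      moreover have "c \<le> (if l i = 0 then 1 else (\<eta> * l i)\<^sup>2 / w i)"
        unfolding c_def by (rule Min_le) auto
      ultimately show ?thesis using False by (simp add: field_simps)
    qed (simp add: w_def)
    define V where "V = (\<lambda>t. \<Sum>i\<in>UNIV. w i * y t i)"
    have step: "V (Suc t) \<ge> (1 + (ms_sum l \<eta> - 1) * c) * V t" for t
    proof -
      have "c * V t \<le> \<eta>\<^sup>2 * (\<Sum>j\<in>UNIV. (l j)\<^sup>2 * y t j)"
        unfolding V_def sum_distrib_left
        using mult_right_mono[OF cw y0] by (intro sum_mono) (simp add: mult_ac power_mult_distrib)
      then have "(ms_sum l \<eta> - 1) * (c * V t)
          \<le> (ms_sum l \<eta> - 1) * (\<eta>\<^sup>2 * (\<Sum>j\<in>UNIV. (l j)\<^sup>2 * y t j))"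
        using W by (intro mult_left_mono) auto
      then show ?thesis
        using ms_map_potential[OF less w_def, of "y t"]
        by (simp add: V_def yS algebra_simps)
    qed
    have "V 0 > 0" unfolding V_def y_def
      using w0 wk z by (intro sum_pos2[of _ k]) auto
    \<comment> \<open>Passes from growth of the weighted potential to growth of the plain
      sum.\<close>
    define M where "M = Max (range w)"
    have M: "w i \<le> M" for i unfolding M_def by (rule Max_ge) auto
    have Mp: "M > 0" using wk M[of k] by linarith
    obtain t where t: "V t > M * C"
      using geometric_growth[of "1 + (ms_sum l \<eta> - 1) * c" V "M * C"] step \<open>V 0 > 0\<close> c W by auto
    have "V t \<le> M * (\<Sum>i\<in>UNIV. y t i)"
      unfolding V_def sum_distrib_left by (intro sum_mono mult_right_mono M y0)
    with t have "M * C < M * (\<Sum>i\<in>UNIV. y t i)" by simp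
    then show ?thesis using Mp by (intro exI[of _ t]) simp
  qed
  then show ?thesis by (simp add: y_def)
qed

section \<open>The threshold equation: monotonicity, existence of a root, bounds\<close>

lemma ms_sum_strict_mono:
  fixes l :: "'n::finite \<Rightarrow> real"
  assumes "0 \<le> \<eta>" "\<eta> < \<eta>'" and l: "\<And>i. l i \<ge> 0" and k: "l k > 0" and less: "\<And>i. \<eta>' * l i < 1"
  shows "ms_sum l \<eta> < ms_sum l \<eta>'"
proof -
  have *: "\<eta> * l i / (2 * (1 - \<eta> * l i)) \<le> \<eta>' * l i / (2 * (1 - \<eta>' * l i))"
    "l i > 0 \<Longrightarrow> \<eta> * l i / (2 * (1 - \<eta> * l i)) < \<eta>' * l i / (2 * (1 - \<eta>' * l i))" for i
  proof -
    have "\<eta> * l i \<le> \<eta>' * l i" using assms(2) l[of i] by (intro mult_right_mono) auto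
    then show "\<eta> * l i / (2 * (1 - \<eta> * l i)) \<le> \<eta>' * l i / (2 * (1 - \<eta>' * l i))"
      using assms(1,2) l[of i] less[of i] by (intro frac_le) auto
  next
    assume "l i > 0"
    then have "\<eta> * l i < \<eta>' * l i" using assms(2) by simp
    then show "\<eta> * l i / (2 * (1 - \<eta> * l i)) < \<eta>' * l i / (2 * (1 - \<eta>' * l i))"
      using assms(1) l[of i] less[of i] by (intro frac_less) auto
  qed
  show ?thesis unfolding ms_sum_def
    using *(1) *(2)[OF k] by (intro sum_strict_mono_ex1) auto
qed

lemma ms_sum_eq_1_exists:
  fixes l :: "'n::finite \<Rightarrow> real"
  assumes l: "\<And>i. l i \<ge> 0" and k: "l k > 0" "\<And>i. l i \<le> l k"
  obtains \<eta> where "\<eta> > 0" "\<eta> * l k < 1" "ms_sum l \<eta> = 1"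
proof -
  \<comment> \<open>Here the top summand alone equals \<open>(2/3) / (2 * (1/3)) = 1\<close>, so the
    intermediate value theorem applies on \<open>{0..b}\<close>, which stays away from every
    pole.\<close>
  define b where "b = 2 / (3 * l k)"
  have b: "b > 0" "b * l k = 2/3" using k by (auto simp: b_def)
  have less: "\<eta> * l i < 1" if "0 \<le> \<eta>" "\<eta> \<le> b" for \<eta> i
  proof -
    have "\<eta> * l i \<le> b * l k" using that l k by (intro mult_mono) auto
    then show ?thesis using b by simp
  qed
  have "1 \<le> ms_sum l b"
  proof -
    have "b * l k / (2 * (1 - b * l k)) \<le> ms_sum l b"
      unfolding ms_sum_def using less[of b] b l
      by (intro member_le_sum divide_nonneg_pos) auto
    then show ?thesis by (simp add: b)
  qed
  moreover have "ms_sum l 0 = 0" by (simp add: ms_sum_def)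
  moreover have "continuous_on {0..b} (ms_sum l)"
    unfolding ms_sum_def using less by (intro continuous_intros) (auto simp: less_imp_neq)
  ultimately obtain \<eta> where \<eta>: "0 \<le> \<eta>" "\<eta> \<le> b" "ms_sum l \<eta> = 1"
    using IVT'[of "ms_sum l" 0 1 b] b by auto
  then have "\<eta> \<noteq> 0" using \<open>ms_sum l 0 = 0\<close> by auto
  then show thesis using \<eta> less[of \<eta> k] that[of \<eta>] by auto
qed

text \<open>Replacing every denominator \<open>1 - \<eta> * l i\<close> by the smallest one,
  \<open>1 - \<eta> * l k\<close>, bounds the sum from above and yields the lower bound on \<eta>;
  replacing it by 1 bounds the sum from below and yields the upper bound.\<close>

lemma ms_sum_eq_1_bounds:
  fixes l :: "'n::finite \<Rightarrow> real"
  assumes l: "\<And>i. l i \<ge> 0" and k: "l k > 0" "\<And>i. l i \<le> l k"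
    and "\<eta> > 0" "\<eta> * l k < 1" "ms_sum l \<eta> = 1"
  shows "2 / (sum l UNIV + 2 * l k) \<le> \<eta>" "\<eta> \<le> 2 / sum l UNIV"
proof -
  have le: "\<eta> * l i \<le> \<eta> * l k" for i using k assms(4) by simp
  have pos: "sum l UNIV > 0" using l k by (intro sum_pos2[of _ k]) auto
  have "ms_sum l \<eta> \<le> (\<Sum>i\<in>UNIV. \<eta> * l i / (2 * (1 - \<eta> * l k)))"
    unfolding ms_sum_def
  proof (rule sum_mono)
    fix i
    have "\<eta> * l i < 1" using le[of i] assms(5) by linarith
    then show "\<eta> * l i / (2 * (1 - \<eta> * l i)) \<le> \<eta> * l i / (2 * (1 - \<eta> * l k))"
      using k(2)[of i] assms(4,5) l[of i] by (intro divide_left_mono mult_pos_pos) auto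
  qed
  also have "\<dots> = \<eta> * sum l UNIV / (2 * (1 - \<eta> * l k))"
    by (simp add: sum_distrib_left sum_divide_distrib)
  finally have "2 \<le> \<eta> * (sum l UNIV + 2 * l k)" using assms(5,6) by (simp add: field_simps)
  then show "2 / (sum l UNIV + 2 * l k) \<le> \<eta>" using pos k by (simp add: field_simps)
  have "(\<Sum>i\<in>UNIV. \<eta> * l i / 2) \<le> ms_sum l \<eta>"
    unfolding ms_sum_def
  proof (rule sum_mono)
    fix i
    have "\<eta> * l i < 1" using le[of i] assms(5) by linarith
    then show "\<eta> * l i / 2 \<le> \<eta> * l i / (2 * (1 - \<eta> * l i))"
      using assms(4) l[of i] by (intro divide_left_mono) auto
  qed
  then have "\<eta> * sum l UNIV \<le> 2" by (simp add: assms(6)) (simp add: sum_distrib_left flip: sum_divide_distrib)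
  then show "\<eta> \<le> 2 / sum l UNIV" using pos by (simp add: field_simps)
qed

section \<open>Moments of the standard Gaussian\<close>

lemma prob_space_std_normal: "prob_space std_normal_distribution"
  using prob_space_normal_density[of 1 0] by simp

lemma borel_measurable_vec_lambda:
  "(\<lambda>v. vec_lambda v :: real^'n) \<in> borel_measurable (PiM UNIV (\<lambda>_::'n. std_normal_distribution))"
  by (subst borel_measurable_euclidean_space) (auto simp: Basis_vec_def inner_axis)

lemma sets_std_gauss [measurable_cong, simp]: "sets (std_gauss :: (real^'n) measure) = sets borel"
  by (simp add: std_gauss_def)

lemma space_std_gauss [simp]: "space (std_gauss :: (real^'n) measure) = UNIV"
  by (simp add: std_gauss_def)

lemma prob_space_std_gauss: "prob_space (std_gauss :: (real^'n) measure)"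
proof -
  interpret product_prob_space "\<lambda>_::'n. std_normal_distribution" UNIV
    by (intro product_prob_spaceI prob_space_std_normal)
  show ?thesis
    unfolding std_gauss_def by (intro P.prob_space_distr borel_measurable_vec_lambda)
qed

text \<open>A linear functional of the noise is a sum of independent centred normals with variances
  \<open>(a $ i)\<^sup>2\<close>. This reduces all required moments to those of one-dimensional
  Gaussians.\<close>

lemma distributed_std_gauss_inner:
  fixes a :: "real^'n"
  assumes "a \<noteq> 0"
  shows "distributed std_gauss lborel (\<lambda>u. a \<bullet> u) (normal_density 0 (norm a))"
proof -
  let ?N = "PiM UNIV (\<lambda>_::'n. std_normal_distribution)"
  interpret product_prob_space "\<lambda>_::'n. std_normal_distribution" UNIV
    by (intro product_prob_spaceI prob_space_std_normal)
  \<comment> \<open>Zero coefficients give degenerate summands without a density, so only the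
    support of \<open>a\<close> enters the sum.\<close>
  define I where "I = {i. a $ i \<noteq> 0}"
  have comp: "distr ?N borel (\<lambda>\<omega>. \<omega> i) = std_normal_distribution" for i
    using PiM_component[of i] by (simp cong: distr_cong)
  have "P.indep_vars (\<lambda>_. borel) (\<lambda>i \<omega>. \<omega> i) UNIV"
  \<comment> \<open>Independence of the coordinates: their joint law is the image of the product
    measure under the identity, hence the product of the marginals.\<close>
  proof (subst P.indep_vars_iff_distr_eq_PiM)
    show "distr ?N (Pi\<^sub>M UNIV (\<lambda>_. borel)) (\<lambda>x. \<lambda>i\<in>UNIV. x i) =
        Pi\<^sub>M UNIV (\<lambda>i. distr ?N borel (\<lambda>\<omega>. \<omega> i))"
      unfolding comp by (simp add: restrict_UNIV) (subst distr_id2, auto intro!: sets_PiM_cong)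
  qed auto
  then have indep: "P.indep_vars (\<lambda>_. borel) (\<lambda>i \<omega>. a $ i * \<omega> i) I"
    by (intro P.indep_vars_compose2[where Y = "\<lambda>i x. a $ i * x" and N = "\<lambda>_. borel"])
      (auto intro: P.indep_vars_subset)
  have normal: "distributed ?N lborel (\<lambda>\<omega>. a $ i * \<omega> i) (normal_density 0 \<bar>a $ i\<bar>)" if "i \<in> I" for i
  proof -
    have "distributed ?N lborel (\<lambda>\<omega>. \<omega> i) std_normal_density"
      unfolding distributed_def using comp[of i] by (auto cong: distr_cong)
    from P.normal_density_affine[OF this, of "a $ i" 0] that show ?thesis by (simp add: I_def)
  qed
  have "I \<noteq> {}" using assms by (auto simp: I_def vec_eq_iff)
  then have "distributed ?N lborel (\<lambda>\<omega>. \<Sum>i\<in>I. a $ i * \<omega> i)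
      (normal_density (\<Sum>i\<in>I. 0) (sqrt (\<Sum>i\<in>I. \<bar>a $ i\<bar>\<^sup>2)))"
    by (intro P.sum_indep_normal indep normal) (auto simp: I_def)
  moreover have "(\<Sum>i\<in>I. a $ i * \<omega> i) = a \<bullet> vec_lambda \<omega>" for \<omega>
    unfolding inner_vec_def I_def by (auto intro!: sum.mono_neutral_left)
  moreover have "sqrt (\<Sum>i\<in>I. \<bar>a $ i\<bar>\<^sup>2) = norm a"
    unfolding norm_vec_def L2_set_def I_def real_sqrt_eq_iff by (auto intro!: sum.mono_neutral_left)
  ultimately have D: "distributed ?N lborel (\<lambda>\<omega>. a \<bullet> vec_lambda \<omega>) (normal_density 0 (norm a))"
    by simp
  have "distr std_gauss lborel (\<lambda>u. a \<bullet> u) = distr ?N lborel ((\<lambda>u. a \<bullet> u) \<circ> vec_lambda)"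
    unfolding std_gauss_def by (intro distr_distr borel_measurable_vec_lambda) simp
  with D show ?thesis by (auto simp: distributed_def comp_def)
qed

text \<open>Moments of order 1, 2 and 4 of a centred normal with standard deviation
  \<open>norm a\<close>. The case \<open>a = 0\<close> is separate because there is no
  density.\<close>

lemma has_bochner_integral_std_gauss_inner_power:
  fixes a :: "real^'n"
  shows "has_bochner_integral std_gauss (\<lambda>u. a \<bullet> u) 0"
    and "has_bochner_integral std_gauss (\<lambda>u. (a \<bullet> u)\<^sup>2) (a \<bullet> a)"
    and "has_bochner_integral std_gauss (\<lambda>u. (a \<bullet> u)^4) (3 * (a \<bullet> a)\<^sup>2)"
proof -
  interpret prob_space "std_gauss :: (real^'n) measure" by (rule prob_space_std_gauss)
  have *: "has_bochner_integral std_gauss (\<lambda>u. (a \<bullet> u)^k) c"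
    if "a \<noteq> 0" "has_bochner_integral lborel (\<lambda>x. normal_density 0 (norm a) x * (x - 0)^k) c" for k c
    using distributed_integrable[OF distributed_std_gauss_inner[OF that(1)], of "\<lambda>x. x^k"]
      distributed_integral[OF distributed_std_gauss_inner[OF that(1)], of "\<lambda>x. x^k"] that(2)
    by (simp add: has_bochner_integral_iff normal_density_nonneg)
  show "has_bochner_integral std_gauss (\<lambda>u. a \<bullet> u) 0"
    using *[of 1] normal_moment_odd[of "norm a" 0 0] by (cases "a = 0") auto
  show "has_bochner_integral std_gauss (\<lambda>u. (a \<bullet> u)\<^sup>2) (a \<bullet> a)"
    using *[of 2] normal_moment_even[of "norm a" 0 1]
    by (cases "a = 0") (auto simp: power2_norm_eq_inner fact_numeral)
  show "has_bochner_integral std_gauss (\<lambda>u. (a \<bullet> u)^4) (3 * (a \<bullet> a)\<^sup>2)"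
    using *[of 4] normal_moment_even[of "norm a" 0 2]
    by (cases "a = 0") (auto simp: power2_norm_eq_inner fact_numeral power_divide)
qed

text \<open>Polarization of the second moment:
  \<open>x * y = ((x + y)\<^sup>2 - (x - y)\<^sup>2) / 4\<close>.\<close>

lemma has_bochner_integral_std_gauss_inner_mult:
  fixes a b :: "real^'n"
  shows "has_bochner_integral std_gauss (\<lambda>u. (a \<bullet> u) * (b \<bullet> u)) (a \<bullet> b)"
proof -
  have "has_bochner_integral std_gauss (\<lambda>u. (((a + b) \<bullet> u)\<^sup>2 - ((a - b) \<bullet> u)\<^sup>2) / 4)
      (((a + b) \<bullet> (a + b) - (a - b) \<bullet> (a - b)) / 4)"
    by (intro has_bochner_integral_divide has_bochner_integral_diff
        has_bochner_integral_std_gauss_inner_power)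
  then show ?thesis
    by (simp add: inner_add_left inner_diff_left inner_add_right inner_diff_right
        power2_eq_square algebra_simps inner_commute)
qed

text \<open>Polarization reduces this to fourth moments of one-dimensional Gaussians.\<close>

lemma has_bochner_integral_std_gauss_inner_sq_mult_sq:
  fixes a b :: "real^'n"
  shows "has_bochner_integral std_gauss (\<lambda>u. (a \<bullet> u)\<^sup>2 * (b \<bullet> u)\<^sup>2)
    ((a \<bullet> a) * (b \<bullet> b) + 2 * (a \<bullet> b)\<^sup>2)"
proof -
  have "has_bochner_integral std_gauss
      (\<lambda>u. (((a + b) \<bullet> u)^4 + ((a - b) \<bullet> u)^4 - 2 * (a \<bullet> u)^4 - 2 * (b \<bullet> u)^4) / 12)
      ((3 * ((a + b) \<bullet> (a + b))\<^sup>2 + 3 * ((a - b) \<bullet> (a - b))\<^sup>2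
        - 2 * (3 * (a \<bullet> a)\<^sup>2) - 2 * (3 * (b \<bullet> b)\<^sup>2)) / 12)"
    by (intro has_bochner_integral_divide has_bochner_integral_diff has_bochner_integral_add
        has_bochner_integral_mult_right has_bochner_integral_std_gauss_inner_power)
  moreover have "((x + y)^4 + (x - y)^4 - 2 * x^4 - 2 * y^4) / 12 = x\<^sup>2 * y\<^sup>2" for x y :: real
    by (simp add: power4_eq_xxxx power2_eq_square algebra_simps)
  moreover have "(3 * (x + y + 2 * z)\<^sup>2 + 3 * (x + y - 2 * z)\<^sup>2 - 2 * (3 * x\<^sup>2) - 2 * (3 * y\<^sup>2)) / 12
      = x * y + 2 * z\<^sup>2" for x y z :: real
    by (simp add: power2_eq_square algebra_simps)
  moreover have "(a + b) \<bullet> (a + b) = a \<bullet> a + b \<bullet> b + 2 * (a \<bullet> b)"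
    "(a - b) \<bullet> (a - b) = a \<bullet> a + b \<bullet> b - 2 * (a \<bullet> b)"
    by (simp_all add: inner_add_left inner_diff_left inner_add_right inner_diff_right inner_commute)
  ultimately show ?thesis by (simp add: inner_add_left inner_diff_left add_divide_distrib)
qed

text \<open>A central difference of a quadratic is its exact directional derivative, since the
  even-order terms cancel. The smoothing parameter therefore drops out of the dynamics.\<close>

lemma zo_step_fquad:
  fixes H :: "real^'n^'n"
  assumes "transpose H = H" "\<mu> \<noteq> 0"
  shows "zo_step (fquad c H xs) \<eta> \<mu> x u - xs = (x - xs) - (\<eta> * ((H *v (x - xs)) \<bullet> u)) *\<^sub>R u"
proof -
  define e where "e = x - xs"
  have sym: "u \<bullet> (H *v e) = e \<bullet> (H *v u)"
    using assms(1) by (metis dot_lmul_matrix transpose_matrix_vector inner_commute)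
  have "fquad c H xs (x + \<mu> *\<^sub>R u) - fquad c H xs (x - \<mu> *\<^sub>R u) = 2 * \<mu> * ((H *v e) \<bullet> u)"
  proof -
    have e: "x + \<mu> *\<^sub>R u - xs = e + \<mu> *\<^sub>R u" "x - \<mu> *\<^sub>R u - xs = e - \<mu> *\<^sub>R u"
      by (simp_all add: e_def)
    show ?thesis unfolding fquad_def e using sym
      by (simp add: matrix_vector_right_distrib matrix_vector_mult_diff_distrib
          matrix_vector_mult_scaleR inner_add_left inner_add_right inner_diff_left inner_diff_right
          algebra_simps inner_commute)
  qed
  then show ?thesis using assms(2) by (simp add: zo_step_def e_def)
qed

section \<open>Iterates as a Markov chain\<close>

lemma has_bochner_integral_prob_space_const:
  fixes c :: real
  assumes "prob_space M"
  shows "has_bochner_integral M (\<lambda>_. c) c"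
proof -
  interpret prob_space M by fact
  show ?thesis by (simp add: has_bochner_integral_iff prob_space)
qed

text \<open>With \<open>h = H (x - xs)\<close>, expanding the step leaves only the mixed moments of
  \<open>h \<bullet> u\<close> and \<open>w \<bullet> u\<close> computed above. The test direction
  \<open>w\<close> will be a unit eigenvector, for which \<open>w \<bullet> h\<close> is a multiple
  of \<open>w \<bullet> (x - xs)\<close> and the recursion closes.\<close>

lemma has_bochner_integral_zo_step:
  fixes H :: "real^'n^'n"
  assumes "transpose H = H" "\<mu> \<noteq> 0"
  shows "has_bochner_integral std_gauss (\<lambda>u. w \<bullet> (zo_step (fquad c H xs) \<eta> \<mu> x u - xs))
      (w \<bullet> (x - xs) - \<eta> * (w \<bullet> (H *v (x - xs))))" (is ?A)
    and "has_bochner_integral std_gauss (\<lambda>u. (w \<bullet> (zo_step (fquad c H xs) \<eta> \<mu> x u - xs))\<^sup>2)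
      ((w \<bullet> (x - xs))\<^sup>2 - 2 * \<eta> * (w \<bullet> (x - xs)) * (w \<bullet> (H *v (x - xs)))
        + \<eta>\<^sup>2 * ((norm (H *v (x - xs)))\<^sup>2 * (norm w)\<^sup>2 + 2 * (w \<bullet> (H *v (x - xs)))\<^sup>2))" (is ?B)
proof -
  define e where "e = x - xs"
  define h where "h = H *v e"
  have step: "w \<bullet> (zo_step (fquad c H xs) \<eta> \<mu> x u - xs) = w \<bullet> e - \<eta> * ((h \<bullet> u) * (w \<bullet> u))" for u
    by (simp add: zo_step_fquad[OF assms] e_def h_def inner_diff_right)
  have "has_bochner_integral std_gauss (\<lambda>u. w \<bullet> e - \<eta> * ((h \<bullet> u) * (w \<bullet> u)))
      (w \<bullet> e - \<eta> * (h \<bullet> w))"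
    by (intro has_bochner_integral_diff has_bochner_integral_mult_right
        has_bochner_integral_std_gauss_inner_mult
        has_bochner_integral_prob_space_const prob_space_std_gauss)
  then show ?A unfolding step by (simp add: e_def h_def inner_commute)
  have sq: "(w \<bullet> e - \<eta> * ((h \<bullet> u) * (w \<bullet> u)))\<^sup>2 = (w \<bullet> e)\<^sup>2
      - (2 * \<eta> * (w \<bullet> e)) * ((h \<bullet> u) * (w \<bullet> u)) + \<eta>\<^sup>2 * ((h \<bullet> u)\<^sup>2 * (w \<bullet> u)\<^sup>2)" for u
    by (simp add: power2_eq_square algebra_simps)
  have "has_bochner_integral std_gauss (\<lambda>u. (w \<bullet> e - \<eta> * ((h \<bullet> u) * (w \<bullet> u)))\<^sup>2)
      ((w \<bullet> e)\<^sup>2 - (2 * \<eta> * (w \<bullet> e)) * (h \<bullet> w) + \<eta>\<^sup>2 * ((h \<bullet> h) * (w \<bullet> w) + 2 * (h \<bullet> w)\<^sup>2))"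
    unfolding sq
    by (intro has_bochner_integral_diff has_bochner_integral_add has_bochner_integral_mult_right
        has_bochner_integral_std_gauss_inner_mult has_bochner_integral_std_gauss_inner_sq_mult_sq
        has_bochner_integral_prob_space_const prob_space_std_gauss)
  then show ?B unfolding step by (simp add: e_def h_def inner_commute power2_norm_eq_inner)
qed

text \<open>The recursion appends a last step; this form peels off the first step instead, matching
  the splitting of the noise sequence into head and tail.\<close>

lemma zo_iter_case_nat:
  "zo_iter F \<eta> \<mu> x0 (case_nat u \<omega>) (Suc t) = zo_iter F \<eta> \<mu> (zo_step F \<eta> \<mu> x0 u) \<omega> t"
  by (induction t) auto

lemma borel_measurable_fquad [measurable]: "fquad c H xs \<in> borel_measurable borel"
  unfolding fquad_def
  by (intro borel_measurable_continuous_onI continuous_intros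
      bounded_linear.continuous_on[OF matrix_vector_mul_bounded_linear])

lemma sequence_space_std_gauss: "sequence_space (std_gauss :: (real^'n) measure)"
  unfolding sequence_space_def by (intro product_prob_spaceI prob_space_std_gauss)

lemma prob_space_gauss_noise: "prob_space (gauss_noise :: (nat \<Rightarrow> real^'n) measure)"
  unfolding gauss_noise_def by (intro prob_space_PiM prob_space_std_gauss)

section \<open>Markov property of the iterates\<close>

context
  fixes F :: "real^'n \<Rightarrow> real" and \<eta> \<mu> :: real
  assumes F [measurable]: "F \<in> borel_measurable borel"
begin

lemma borel_measurable_zo_iter [measurable]:
  "(\<lambda>\<omega>. zo_iter F \<eta> \<mu> x0 \<omega> t) \<in> borel_measurable gauss_noise"
  unfolding gauss_noise_def by (induction t) (simp_all add: zo_step_def)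

lemma case_nat_measurable_gauss_noise [measurable]:
  "(\<lambda>(u, \<omega>). case_nat u \<omega>) \<in> std_gauss \<Otimes>\<^sub>M gauss_noise \<rightarrow>\<^sub>M gauss_noise"
  unfolding gauss_noise_def by measurable

lemma borel_measurable_zo_iter_pair:
  "(\<lambda>(u, \<omega>). zo_iter F \<eta> \<mu> (zo_step F \<eta> \<mu> x0 u) \<omega> t) \<in> borel_measurable (std_gauss \<Otimes>\<^sub>M gauss_noise)"
  using measurable_compose[OF case_nat_measurable_gauss_noise borel_measurable_zo_iter, of x0 "Suc t"]
  by (simp add: split_def zo_iter_case_nat del: zo_iter.simps)

lemma gauss_noise_iter:
  "distr (std_gauss \<Otimes>\<^sub>M gauss_noise) gauss_noise (\<lambda>(u, \<omega>). case_nat u \<omega>)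
    = (gauss_noise :: (nat \<Rightarrow> real^'n) measure)"
  unfolding gauss_noise_def by (rule sequence_space.PiM_iter[OF sequence_space_std_gauss])

text \<open>Prepending an independent sample preserves the law of the noise, so Tonelli's theorem
  lets the first sample be integrated last, with the chain restarted from the point it
  produces.\<close>

lemma nn_integral_zo_iter_Suc:
  assumes [measurable]: "g \<in> borel_measurable borel"
  shows "(\<integral>\<^sup>+\<omega>. g (zo_iter F \<eta> \<mu> x0 \<omega> (Suc t)) \<partial>gauss_noise) =
    (\<integral>\<^sup>+u. (\<integral>\<^sup>+\<omega>. g (zo_iter F \<eta> \<mu> (zo_step F \<eta> \<mu> x0 u) \<omega> t) \<partial>gauss_noise) \<partial>std_gauss)"
proof -
  interpret prob_space "gauss_noise :: (nat \<Rightarrow> real^'n) measure" by (rule prob_space_gauss_noise)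
  note borel_measurable_zo_iter_pair[measurable]
  have "(\<integral>\<^sup>+\<omega>. g (zo_iter F \<eta> \<mu> x0 \<omega> (Suc t)) \<partial>gauss_noise) =
      (\<integral>\<^sup>+p. g (zo_iter F \<eta> \<mu> (zo_step F \<eta> \<mu> x0 (fst p)) (snd p) t) \<partial>(std_gauss \<Otimes>\<^sub>M gauss_noise))"
    by (subst gauss_noise_iter[symmetric], subst nn_integral_distr)
      (simp_all add: split_def zo_iter_case_nat del: zo_iter.simps)
  also have "\<dots> = (\<integral>\<^sup>+u. (\<integral>\<^sup>+\<omega>. g (zo_iter F \<eta> \<mu> (zo_step F \<eta> \<mu> x0 u) \<omega> t) \<partial>gauss_noise) \<partial>std_gauss)"
    using borel_measurable_zo_iter_pair[of x0 t] by (subst nn_integral_fst[symmetric]) (auto simp: split_def)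
  finally show ?thesis .
qed

text \<open>Averages over the last step rather than the first. Applying the first-step decomposition
  on both sides and inducting over all starting points replaces conditioning on the past.\<close>

lemma nn_integral_zo_iter_Suc':
  assumes [measurable]: "g \<in> borel_measurable borel" "g' \<in> borel_measurable borel"
    and g': "\<And>x. (\<integral>\<^sup>+u. g (zo_step F \<eta> \<mu> x u) \<partial>std_gauss) = g' x"
  shows "(\<integral>\<^sup>+\<omega>. g (zo_iter F \<eta> \<mu> x0 \<omega> (Suc t)) \<partial>gauss_noise) =
    (\<integral>\<^sup>+\<omega>. g' (zo_iter F \<eta> \<mu> x0 \<omega> t) \<partial>gauss_noise)"
proof (induction t arbitrary: x0)
  case 0
  interpret prob_space "gauss_noise :: (nat \<Rightarrow> real^'n) measure" by (rule prob_space_gauss_noise)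
  show ?case by (subst nn_integral_zo_iter_Suc) (simp_all add: g' emeasure_space_1)
next
  case (Suc t)
  show ?case by (simp only: nn_integral_zo_iter_Suc assms(1,2) Suc)
qed

text \<open>First-step decomposition for signed functions, where Fubini's theorem takes
  integrability at the later time as input.\<close>

lemma integral_zo_iter_Suc:
  fixes g :: "real^'n \<Rightarrow> real"
  assumes [measurable]: "g \<in> borel_measurable borel"
    and int: "integrable gauss_noise (\<lambda>\<omega>. g (zo_iter F \<eta> \<mu> x0 \<omega> (Suc t)))"
  shows "(\<integral>\<omega>. g (zo_iter F \<eta> \<mu> x0 \<omega> (Suc t)) \<partial>gauss_noise) =
    (\<integral>u. (\<integral>\<omega>. g (zo_iter F \<eta> \<mu> (zo_step F \<eta> \<mu> x0 u) \<omega> t) \<partial>gauss_noise) \<partial>std_gauss)"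
proof -
  interpret G: prob_space "std_gauss :: (real^'n) measure" by (rule prob_space_std_gauss)
  interpret S: prob_space "gauss_noise :: (nat \<Rightarrow> real^'n) measure" by (rule prob_space_gauss_noise)
  interpret pair_prob_space "std_gauss :: (real^'n) measure" "gauss_noise :: (nat \<Rightarrow> real^'n) measure" ..
  let ?f = "\<lambda>p. g (zo_iter F \<eta> \<mu> (zo_step F \<eta> \<mu> x0 (fst p)) (snd p) t)"
  have "integrable (std_gauss \<Otimes>\<^sub>M gauss_noise) ?f"
    using int by (subst (asm) gauss_noise_iter[symmetric], subst (asm) integrable_distr_eq)
      (simp_all add: split_def zo_iter_case_nat del: zo_iter.simps)
  moreover have "(\<integral>\<omega>. g (zo_iter F \<eta> \<mu> x0 \<omega> (Suc t)) \<partial>gauss_noise) =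
      (\<integral>p. ?f p \<partial>(std_gauss \<Otimes>\<^sub>M gauss_noise))"
    by (subst gauss_noise_iter[symmetric], subst integral_distr)
      (simp_all add: split_def zo_iter_case_nat del: zo_iter.simps)
  ultimately show ?thesis using integral_fst'[of ?f] by simp
qed

end

section \<open>Iterates in an eigenbasis\<close>

locale orthonormal_eigenbasis =
  fixes H :: "real^'n^'n" and lam :: "'n \<Rightarrow> real" and v :: "'n \<Rightarrow> real^'n"
  assumes sym: "transpose H = H"
    and orthonormal: "\<And>i j. v i \<bullet> v j = (if i = j then 1 else 0)"
    and eigen: "\<And>i. H *v v i = lam i *\<^sub>R v i"
begin

definition eigenmatrix :: "real^'n^'n" where "eigenmatrix = (\<chi> i. v i)"

lemma orthogonal_eigenmatrix: "orthogonal_matrix eigenmatrix"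
  unfolding orthogonal_matrix_orthonormal_rows
  by (auto simp: eigenmatrix_def row_def norm_eq_1 orthogonal_def orthonormal)

text \<open>Parseval's identity: the matrix with rows \<open>v i\<close> is an isometry, and its
  action lists the coordinates in the eigenbasis.\<close>

lemma norm_sq_eq_sum_coords: "(norm x)\<^sup>2 = (\<Sum>i\<in>UNIV. (v i \<bullet> x)\<^sup>2)"
proof -
  have "norm (eigenmatrix *v x) = norm x"
    using orthogonal_eigenmatrix orthogonal_transformation_matrix[of "(*v) eigenmatrix"]
    by (auto simp: orthogonal_transformation)
  moreover have "(eigenmatrix *v x) $ i = v i \<bullet> x" for i
    by (simp add: eigenmatrix_def matrix_vector_mult_def inner_vec_def)
  then have "(norm (eigenmatrix *v x))\<^sup>2 = (\<Sum>i\<in>UNIV. (v i \<bullet> x)\<^sup>2)"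
    unfolding power2_norm_eq_inner inner_vec_def[of "eigenmatrix *v x"] by (simp add: power2_eq_square)
  ultimately show ?thesis by simp
qed

text \<open>By cyclicity the trace may be computed after conjugation by \<open>eigenmatrix\<close>,
  where the diagonal entries are \<open>v i \<bullet> (H *v v i)\<close>.\<close>

lemma trace_eq_sum_eigenvalues: "trace H = sum lam UNIV"
proof -
  have "trace (eigenmatrix ** (H ** transpose eigenmatrix)) = trace ((H ** transpose eigenmatrix) ** eigenmatrix)" by (rule trace_mul_sym)
  also have "\<dots> = trace H"
    using orthogonal_eigenmatrix by (simp add: orthogonal_matrix flip: matrix_mul_assoc)
  finally have "trace H = (\<Sum>i\<in>UNIV. (eigenmatrix ** (H ** transpose eigenmatrix)) $ i $ i)" by (simp add: trace_def)
  also have "\<dots> = (\<Sum>i\<in>UNIV. v i \<bullet> (H *v v i))"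
    by (simp add: eigenmatrix_def matrix_matrix_mult_def matrix_vector_mult_def inner_vec_def transpose_def)
  finally show ?thesis by (simp add: eigen orthonormal)
qed

lemma inner_eigen: "v i \<bullet> (H *v x) = lam i * (v i \<bullet> x)"
  using symmetric_matrix_inner[OF sym, of "v i" x] by (simp add: eigen)

lemma norm_sq_matrix: "(norm (H *v x))\<^sup>2 = (\<Sum>i\<in>UNIV. (lam i)\<^sup>2 * (v i \<bullet> x)\<^sup>2)"
  by (simp add: norm_sq_eq_sum_coords inner_eigen power_mult_distrib)

section \<open>Exact second moments and means of the iterates\<close>

context
  fixes c \<mu> :: real and xs :: "real^'n"
  assumes \<mu>: "\<mu> \<noteq> 0"
begin

abbreviation iter where "iter \<eta> x0 \<omega> t \<equiv> zo_iter (fquad c H xs) \<eta> \<mu> x0 \<omega> t"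

text \<open>One averaged step sends the squared coordinates to a combination of themselves with
  nonnegative coefficients, which passes through the nonnegative integral. Working in
  \<open>ennreal\<close> thus needs no prior integrability; finiteness is read off the
  result.\<close>

lemma nn_integral_zo_iter_coord_sq:
  "(\<integral>\<^sup>+\<omega>. ennreal ((v i \<bullet> (iter \<eta> x0 \<omega> t - xs))\<^sup>2) \<partial>gauss_noise) =
    ennreal ((ms_map \<eta> lam ^^ t) (\<lambda>j. (v j \<bullet> (x0 - xs))\<^sup>2) i)"
proof (induction t arbitrary: i)
  case 0
  interpret prob_space "gauss_noise :: (nat \<Rightarrow> real^'n) measure" by (rule prob_space_gauss_noise)
  show ?case by (simp add: emeasure_space_1)
next
  case (Suc t)
  let ?q = "\<lambda>i x. (v i \<bullet> (x - xs))\<^sup>2"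
  let ?y = "(ms_map \<eta> lam ^^ t) (\<lambda>j. ?q j x0)"
  let ?a = "1 - 2 * (\<eta> * lam i) + 2 * (\<eta> * lam i)\<^sup>2"
  have a: "?a \<ge> 0" by (rule less_imp_le[OF ms_coeff_pos])
  have y: "?y j \<ge> 0" for j by (rule ms_map_funpow_nonneg) simp
  have step: "(\<integral>\<^sup>+u. ennreal (?q i (zo_step (fquad c H xs) \<eta> \<mu> x u)) \<partial>std_gauss) =
      ennreal ?a * ennreal (?q i x) + ennreal (\<eta>\<^sup>2) * (\<Sum>j\<in>UNIV. ennreal ((lam j)\<^sup>2) * ennreal (?q j x))" for x
  proof -
    have "has_bochner_integral std_gauss (\<lambda>u. ?q i (zo_step (fquad c H xs) \<eta> \<mu> x u))
        (ms_map \<eta> lam (\<lambda>j. ?q j x) i)"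
      using has_bochner_integral_zo_step(2)[OF sym \<mu>, of "v i" c xs \<eta> x]
      by (simp add: inner_eigen norm_sq_matrix ms_map_def norm_eq_1[THEN iffD2] orthonormal)
        (simp add: power2_eq_square algebra_simps)
    then have "(\<integral>\<^sup>+u. ennreal (?q i (zo_step (fquad c H xs) \<eta> \<mu> x u)) \<partial>std_gauss) =
        ennreal (ms_map \<eta> lam (\<lambda>j. ?q j x) i)"
      by (subst nn_integral_eq_integral) (auto simp: has_bochner_integral_iff)
    also have "\<dots> = ennreal (?a * ?q i x) + ennreal (\<eta>\<^sup>2 * (\<Sum>j\<in>UNIV. (lam j)\<^sup>2 * ?q j x))"
      unfolding ms_map_def using a
      by (intro ennreal_plus mult_nonneg_nonneg sum_nonneg) auto
    finally show ?thesis
      using a by (simp add: ennreal_mult sum_nonneg flip: sum_ennreal)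
  qed
  have meas: "(\<lambda>\<omega>. ennreal (?q j (iter \<eta> x0 \<omega> t))) \<in> borel_measurable gauss_noise" for j
    using borel_measurable_zo_iter[OF borel_measurable_fquad, of c H xs \<eta> \<mu> x0 t] by measurable
  have "(\<integral>\<^sup>+\<omega>. ennreal (?q i (iter \<eta> x0 \<omega> (Suc t))) \<partial>gauss_noise) =
      (\<integral>\<^sup>+\<omega>. (ennreal ?a * ennreal (?q i (iter \<eta> x0 \<omega> t)) + ennreal (\<eta>\<^sup>2) *
        (\<Sum>j\<in>UNIV. ennreal ((lam j)\<^sup>2) * ennreal (?q j (iter \<eta> x0 \<omega> t)))) \<partial>gauss_noise)"
    by (rule nn_integral_zo_iter_Suc'[OF borel_measurable_fquad _ _ step]) measurable
  also have "\<dots> = ennreal ?a * ennreal (?y i) + ennreal (\<eta>\<^sup>2) *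
        (\<Sum>j\<in>UNIV. ennreal ((lam j)\<^sup>2) * ennreal (?y j))"
    using meas by (simp add: nn_integral_add nn_integral_cmult nn_integral_sum Suc)
  also have "\<dots> = ennreal (?a * ?y i) + ennreal (\<eta>\<^sup>2 * (\<Sum>j\<in>UNIV. (lam j)\<^sup>2 * ?y j))"
    using a y by (simp add: ennreal_mult sum_nonneg flip: sum_ennreal)
  also have "\<dots> = ennreal (ms_map \<eta> lam ?y i)"
    unfolding ms_map_def[of \<eta> lam ?y] using a y
    by (intro ennreal_plus[symmetric] mult_nonneg_nonneg sum_nonneg) auto
  finally show ?case by simp
qed

lemma nn_integral_zo_iter_norm_sq:
  "(\<integral>\<^sup>+\<omega>. ennreal ((norm (iter \<eta> x0 \<omega> t - xs))\<^sup>2) \<partial>gauss_noise) =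
    ennreal (\<Sum>i\<in>UNIV. (ms_map \<eta> lam ^^ t) (\<lambda>j. (v j \<bullet> (x0 - xs))\<^sup>2) i)"
proof -
  have meas: "(\<lambda>\<omega>. ennreal ((v j \<bullet> (iter \<eta> x0 \<omega> t - xs))\<^sup>2)) \<in> borel_measurable gauss_noise" for j
    using borel_measurable_zo_iter[OF borel_measurable_fquad, of c H xs \<eta> \<mu> x0 t] by measurable
  have "(\<integral>\<^sup>+\<omega>. ennreal ((norm (iter \<eta> x0 \<omega> t - xs))\<^sup>2) \<partial>gauss_noise) =
      (\<integral>\<^sup>+\<omega>. (\<Sum>i\<in>UNIV. ennreal ((v i \<bullet> (iter \<eta> x0 \<omega> t - xs))\<^sup>2)) \<partial>gauss_noise)"
    by (simp add: norm_sq_eq_sum_coords)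
  also have "\<dots> = (\<Sum>i\<in>UNIV. ennreal ((ms_map \<eta> lam ^^ t) (\<lambda>j. (v j \<bullet> (x0 - xs))\<^sup>2) i))"
    using meas by (simp add: nn_integral_sum nn_integral_zo_iter_coord_sq del: sum_ennreal)
  finally show ?thesis
    by (simp add: sum_ennreal ms_map_funpow_nonneg)
qed

text \<open>Finite second moments on a probability space imply integrability, as the mean
  computation requires.\<close>

lemma integrable_zo_iter: "integrable gauss_noise (\<lambda>\<omega>. iter \<eta> x0 \<omega> t - xs)"
proof -
  interpret prob_space "gauss_noise :: (nat \<Rightarrow> real^'n) measure" by (rule prob_space_gauss_noise)
  have [measurable]: "(\<lambda>\<omega>. iter \<eta> x0 \<omega> t) \<in> borel_measurable gauss_noise"
    by (rule borel_measurable_zo_iter[OF borel_measurable_fquad])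
  have "integrable gauss_noise (\<lambda>\<omega>. (norm (iter \<eta> x0 \<omega> t - xs))\<^sup>2)"
    by (intro integrableI_nonneg) (auto simp: nn_integral_zo_iter_norm_sq simp del: zo_iter.simps)
  then have "integrable gauss_noise (\<lambda>\<omega>. norm (iter \<eta> x0 \<omega> t - xs))"
    by (rule square_integrable_imp_integrable[rotated]) measurable
  then show ?thesis by (rule integrable_norm_cancel) measurable
qed

text \<open>Induction over all starting points: after the first step the hypothesis gives a fixed
  multiple of the new coordinate, whose average is \<open>1 - \<eta> * lam i\<close> times the old
  one.\<close>

lemma integral_zo_iter_coord:
  "v i \<bullet> (\<integral>\<omega>. (iter \<eta> x0 \<omega> t - xs) \<partial>gauss_noise) = (1 - \<eta> * lam i) ^ t * (v i \<bullet> (x0 - xs))"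
proof -
  interpret prob_space "gauss_noise :: (nat \<Rightarrow> real^'n) measure" by (rule prob_space_gauss_noise)
  have "(\<integral>\<omega>. v i \<bullet> (iter \<eta> x0 \<omega> t - xs) \<partial>gauss_noise) = (1 - \<eta> * lam i) ^ t * (v i \<bullet> (x0 - xs))"
  proof (induction t arbitrary: x0)
    case 0
    then show ?case by (simp add: prob_space)
  next
    case (Suc t)
    have "(\<integral>\<omega>. v i \<bullet> (iter \<eta> x0 \<omega> (Suc t) - xs) \<partial>gauss_noise) =
        (\<integral>u. (\<integral>\<omega>. v i \<bullet> (iter \<eta> (zo_step (fquad c H xs) \<eta> \<mu> x0 u) \<omega> t - xs) \<partial>gauss_noise) \<partial>std_gauss)"
      using integrable_zo_iter[of \<eta> x0 "Suc t"]
      by (intro integral_zo_iter_Suc[OF borel_measurable_fquad] integrable_inner_right) auto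
    also have "\<dots> = (1 - \<eta> * lam i) ^ t * (v i \<bullet> (x0 - xs) - \<eta> * (v i \<bullet> (H *v (x0 - xs))))"
      using has_bochner_integral_zo_step(1)[OF sym \<mu>, of "v i" c xs \<eta> x0]
      by (simp add: Suc has_bochner_integral_iff)
    finally show ?case by (simp add: inner_eigen algebra_simps)
  qed
  then show ?thesis using integrable_zo_iter by simp
qed

end

end

section \<open>Critical step sizes\<close>

context orthonormal_eigenbasis
begin

text \<open>The admissible set is exactly \<open>{0<..2 / lam k}\<close>: up to the endpoint,
  included, every factor \<open>1 - \<eta> * lam i\<close> has modulus at most 1, and beyond it the
  factor of the top mode exceeds 1 in modulus.\<close>

lemma crit_step_mean_fquad:
  assumes \<mu>: "\<mu> \<noteq> 0" and nonneg: "\<And>i. lam i \<ge> 0" and k: "lam k > 0" "\<And>i. lam i \<le> lam k"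
  shows "crit_step_mean (fquad c H xs) \<mu> xs = 2 / lam k"
proof -
  let ?m = "\<lambda>\<eta> x0 t. \<integral>\<omega>. (zo_iter (fquad c H xs) \<eta> \<mu> x0 \<omega> t - xs) \<partial>gauss_noise"
  have bdd: "bdd_above (range (\<lambda>t. norm (?m \<eta> x0 t)))" if "\<eta> > 0" "\<eta> \<le> 2 / lam k" for \<eta> x0
  proof (rule bdd_aboveI2)
    fix t
    have le: "\<bar>1 - \<eta> * lam i\<bar> \<le> 1" for i
    proof -
      have "\<eta> * lam i \<le> \<eta> * lam k" using that k by (intro mult_left_mono) auto
      also have "\<dots> \<le> 2" using that k by (simp add: field_simps)
      finally show ?thesis using that nonneg[of i] by (simp add: abs_le_iff)
    qed
    have "(norm (?m \<eta> x0 t))\<^sup>2 \<le> (norm (x0 - xs))\<^sup>2"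
      unfolding norm_sq_eq_sum_coords integral_zo_iter_coord[OF \<mu>]
    proof (rule sum_mono)
      fix i
      have "\<bar>(1 - \<eta> * lam i) ^ t * (v i \<bullet> (x0 - xs))\<bar> \<le> \<bar>v i \<bullet> (x0 - xs)\<bar>"
        unfolding abs_mult power_abs
        using le[of i] by (intro mult_left_le_one_le power_le_one) auto
      then show "((1 - \<eta> * lam i) ^ t * (v i \<bullet> (x0 - xs)))\<^sup>2 \<le> (v i \<bullet> (x0 - xs))\<^sup>2"
        by (simp only: abs_le_square_iff)
    qed
    then show "norm (?m \<eta> x0 t) \<le> norm (x0 - xs)" by (simp add: power2_le_iff_abs_le)
  qed
  \<comment> \<open>The starting point \<open>xs + v k\<close> excites the top eigenmode with unit
    amplitude.\<close>
  have unbdd: "\<not> bdd_above (range (\<lambda>t. norm (?m \<eta> (xs + v k) t)))" if "\<eta> > 2 / lam k" for \<eta>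
  proof
    assume "bdd_above (range (\<lambda>t. norm (?m \<eta> (xs + v k) t)))"
    then obtain C where C: "\<And>t. norm (?m \<eta> (xs + v k) t) \<le> C" by (auto simp: bdd_above_def)
    have r: "\<bar>1 - \<eta> * lam k\<bar> > 1" using that k by (simp add: field_simps)
    obtain t where "\<bar>1 - \<eta> * lam k\<bar> ^ t > C" using real_arch_pow[OF r] by blast
    moreover have "\<bar>v k \<bullet> ?m \<eta> (xs + v k) t\<bar> \<le> norm (?m \<eta> (xs + v k) t)"
      using Cauchy_Schwarz_ineq2[of "v k" "?m \<eta> (xs + v k) t"] orthonormal[of k k]
      by (simp add: norm_eq_1[THEN iffD2])
    ultimately show False
      using C[of t] by (simp add: integral_zo_iter_coord[OF \<mu>] orthonormal power_abs)
  qed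
  have "{\<eta>. \<eta> > 0 \<and> (\<forall>x0. bdd_above (range (\<lambda>t. norm (?m \<eta> x0 t))))} = {0<..2 / lam k}"
  proof (intro set_eqI iffI)
    fix \<eta> assume "\<eta> \<in> {\<eta>. \<eta> > 0 \<and> (\<forall>x0. bdd_above (range (\<lambda>t. norm (?m \<eta> x0 t))))}"
    then have "\<eta> > 0" "\<forall>x0. bdd_above (range (\<lambda>t. norm (?m \<eta> x0 t)))" by simp_all
    from this(1) spec[OF this(2), of "xs + v k"]
    have "\<eta> > 0" "bdd_above (range (\<lambda>t. norm (?m \<eta> (xs + v k) t)))" .
    then show "\<eta> \<in> {0<..2 / lam k}" using unbdd[of \<eta>] by fastforce
  qed (use bdd in auto)
  then show ?thesis unfolding crit_step_mean_def using k by simp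
qed

text \<open>The admissible set contains every positive step size below \<open>\<eta>'\<close> and
  none above it. This fixes the supremum without deciding whether \<open>\<eta>'\<close> itself is
  admissible.\<close>

lemma crit_step_ms_fquad:
  assumes \<mu>: "\<mu> \<noteq> 0" and nonneg: "\<And>i. lam i \<ge> 0" and k: "lam k > 0" "\<And>i. lam i \<le> lam k"
    and \<eta>': "\<eta>' > 0" "\<eta>' * lam k < 1" "ms_sum lam \<eta>' = 1"
  shows "crit_step_ms (fquad c H xs) \<mu> xs = \<eta>'"
proof -
  define S where "S = {\<eta>. \<eta> > 0 \<and>
     (\<forall>x0. (SUP t. \<integral>\<^sup>+\<omega>. ennreal ((norm (zo_iter (fquad c H xs) \<eta> \<mu> x0 \<omega> t - xs))\<^sup>2) \<partial>gauss_noise) < \<infinity>)}"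
  have less: "\<eta> * lam i < 1" if "0 < \<eta>" "\<eta> * lam k < 1" for \<eta> i
    using mult_left_mono[OF k(2)[of i], of \<eta>] that by linarith
  have stable: "\<eta> \<in> S" if \<eta>: "0 < \<eta>" "\<eta> < \<eta>'" for \<eta>
  proof -
    have 1: "\<eta> * lam i < 1" for i
      using mult_right_mono[of \<eta> \<eta>' "lam i"] \<eta> nonneg[of i] less[OF \<eta>'(1,2), of i] by linarith
    have 2: "ms_sum lam \<eta> < 1"
      using ms_sum_strict_mono[of \<eta> \<eta>' lam k] \<eta> nonneg k less[OF \<eta>'(1,2)] \<eta>'(3) by simp
    have "(SUP t. \<integral>\<^sup>+\<omega>. ennreal ((norm (zo_iter (fquad c H xs) \<eta> \<mu> x0 \<omega> t - xs))\<^sup>2) \<partial>gauss_noise) < \<infinity>" for x0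
    proof -
      obtain C where C: "\<And>t. (\<Sum>i\<in>UNIV. (ms_map \<eta> lam ^^ t) (\<lambda>j. (v j \<bullet> (x0 - xs))\<^sup>2) i) \<le> C"
        using ms_map_bounded[OF \<eta>(1) nonneg 1 2, of "\<lambda>j. (v j \<bullet> (x0 - xs))\<^sup>2"] by auto
      have "(SUP t. \<integral>\<^sup>+\<omega>. ennreal ((norm (zo_iter (fquad c H xs) \<eta> \<mu> x0 \<omega> t - xs))\<^sup>2) \<partial>gauss_noise) \<le> ennreal C"
        unfolding nn_integral_zo_iter_norm_sq[OF \<mu>] by (intro SUP_least ennreal_leI C)
      then show ?thesis by (simp add: le_less_trans)
    qed
    then show ?thesis using \<eta> by (simp add: S_def)
  qed
  have unstable: "\<eta> \<notin> S" if \<eta>: "\<eta> > \<eta>'" for \<eta>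
  proof
    assume "\<eta> \<in> S"
    \<comment> \<open>Total second moment from the start \<open>xs + v k\<close>, whose initial
      coordinate moments are the indicator of \<open>k\<close>.\<close>
    let ?r = "\<lambda>t. \<Sum>i\<in>UNIV. (ms_map \<eta> lam ^^ t) (\<lambda>j. (v j \<bullet> v k)\<^sup>2) i"
    have "(SUP t. ennreal (?r t)) < \<infinity>"
      using \<open>\<eta> \<in> S\<close> nn_integral_zo_iter_norm_sq[OF \<mu>, of c xs \<eta> "xs + v k"]
      by (auto simp: S_def dest: spec[of _ "xs + v k"])
    then obtain C where "C \<ge> 0" and C: "(SUP t. ennreal (?r t)) = ennreal C"
      by (cases "SUP t. ennreal (?r t)") auto
    have "ennreal (?r t) \<le> ennreal C" for t unfolding C[symmetric] by (rule SUP_upper) simp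
    then have le: "?r t \<le> C" for t using \<open>C \<ge> 0\<close> by (simp add: ennreal_le_iff)
    have "\<eta> * lam k \<ge> 1 \<or> ((\<forall>i. \<eta> * lam i < 1) \<and> ms_sum lam \<eta> > 1)"
    proof (cases "\<eta> * lam k < 1")
      case True
      have "ms_sum lam \<eta>' < ms_sum lam \<eta>"
        using less[of \<eta>] True \<eta> \<eta>'(1) nonneg k by (intro ms_sum_strict_mono[of _ _ _ k]) auto
      then show ?thesis using less[of \<eta>] True \<eta> \<eta>' by auto
    qed auto
    then have "\<exists>t. ?r t > C"
      using \<eta> \<eta>'(1) nonneg k by (intro ms_map_unbounded[of \<eta> lam k]) (auto simp: orthonormal)
    then show False using le by (auto simp: not_le[symmetric])
  qed
  have le: "\<eta> \<le> \<eta>'" if "\<eta> \<in> S" for \<eta> using unstable[of \<eta>] that by force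
  have "\<eta>' / 2 \<in> S" using stable[of "\<eta>' / 2"] \<eta>'(1) by simp
  then have "Sup S \<le> \<eta>'" using le by (intro cSup_least) auto
  \<comment> \<open>By density it suffices that each point of the open interval from 0 to
    \<open>\<eta>'\<close> lies in \<open>S\<close>.\<close>
  moreover have "\<eta>' \<le> Sup S"
    using stable le \<eta>'(1) by (intro dense_le_bounded[of 0 \<eta>']) (auto intro!: cSup_upper bdd_aboveI[of S \<eta>'])
  ultimately show ?thesis by (simp add: crit_step_ms_def S_def)
qed

end

theorem theorem4p7:
  fixes f :: "real^'n \<Rightarrow> real" and xs :: "real^'n" and H :: "real^'n^'n"
    and lam :: "'n \<Rightarrow> real" and \<mu> :: real
  assumes "local_minimizer f xs"
    and "twice_diff_near_with_hessian f xs H"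
    and "psd H" and "H \<noteq> 0"
    and "eigenvalues_with_mult H lam"
    and "\<mu> > 0"
  shows "crit_step_mean (fquad (f xs) H xs) \<mu> xs = 2 / Max (range lam)
    \<and> (let \<eta>ms = crit_step_ms (fquad (f xs) H xs) \<mu> xs; lmax = Max (range lam) in
         \<eta>ms > 0 \<and> \<eta>ms * lmax < 1 \<and> (\<Sum>i\<in>UNIV. \<eta>ms * lam i / (2 * (1 - \<eta>ms * lam i))) = 1
       \<and> (\<forall>\<eta>>0. \<eta> * lmax < 1 \<and> (\<Sum>i\<in>UNIV. \<eta> * lam i / (2 * (1 - \<eta> * lam i))) = 1 \<longrightarrow> \<eta> = \<eta>ms)
       \<and> 2 / (trace H + 2 * lmax) \<le> \<eta>ms \<and> \<eta>ms \<le> 2 / trace H)"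
proof -
  have sym: "transpose H = H" and psd: "\<And>x. x \<bullet> (H *v x) \<ge> 0"
    using assms(3) by (auto simp: psd_def)
  obtain v where v: "\<And>i j. v i \<bullet> v j = (if i = j then 1 else 0)"
    "\<And>i. H *v v i = lam i *\<^sub>R v i"
    using eigenvalues_with_mult_orthonormal_basis[OF sym assms(5)] by blast
  interpret orthonormal_eigenbasis H lam v by standard (fact sym v)+
  have nonneg: "lam i \<ge> 0" for i using psd[of "v i"] by (simp add: eigen orthonormal)
  have "Max (range lam) \<in> range lam" by (rule Max_in) auto
  then obtain k where k: "Max (range lam) = lam k" by blast
  then have kmax: "lam i \<le> lam k" for i using Max_ge[of "range lam" "lam i"] by simp
  have "lam k \<noteq> 0"
  proof
    \<comment> \<open>A vanishing largest eigenvalue forces all of them to vanish, so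
      \<open>H\<close> would annihilate every vector.\<close>
    assume "lam k = 0"
    then have "lam i = 0" for i using nonneg[of i] kmax[of i] by simp
    then have "H *v x = 0" for x using norm_sq_matrix[of x] by simp
    then show False using assms(4) by (simp add: matrix_eq)
  qed
  then have kpos: "lam k > 0" using nonneg[of k] by simp
  have \<mu>: "\<mu> \<noteq> 0" using assms(6) by simp
  obtain \<eta>' where \<eta>': "\<eta>' > 0" "\<eta>' * lam k < 1" "ms_sum lam \<eta>' = 1"
    using ms_sum_eq_1_exists[of lam k] nonneg kpos kmax by blast
  note crit = crit_step_ms_fquad[OF \<mu> nonneg kpos kmax, where c = "f xs" and xs = xs]
  \<comment> \<open>Uniqueness: every admissible root of the equation equals the same
    supremum.\<close>
  have "\<eta> = \<eta>'" if "\<eta> > 0" "\<eta> * lam k < 1" "ms_sum lam \<eta> = 1" for \<eta>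
    using crit[OF that] crit[OF \<eta>'] by simp
  then show ?thesis
    unfolding Let_def k crit_step_mean_fquad[OF \<mu> nonneg kpos kmax] crit[OF \<eta>']
      trace_eq_sum_eigenvalues ms_sum_def[symmetric]
    using \<eta>' ms_sum_eq_1_bounds[OF nonneg kpos kmax \<eta>'] by blast
qed

end
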